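(* Let $G$ be a graph without isolated vertices, with $m\ge1$ edges, and let $\lambda=\lambda(G)$ and $\beta=\operatorname{bk}(G)$. Suppose that $\lambda^2>m$. Then $$\beta=\lambda-\frac{2m}{3\lambda}$$ if and only if $G$ is connected and $K_4$-free, every edge of $G$ lies in exactly $\beta$ triangles, and $G-N[v]$ is triangle-free for every vertex $v$.
   Context: Graphs are finite and simple. $\lambda(G)$ is the spectral radius of the adjacency matrix of $G$. The booksize is $\operatorname{bk}(G)=\max_{uv\in E(G)}|N(u)\cap N(v)|$, the maximum number of triangles sharing a common edge. $N[v]=N(v)\cup\{v\}$ is the closed neighborhood of $v$, and $G-N[v]$ is the graph obtained from $G$ by deleting the vertices of $N[v]$. *)

theory Defs
  imports
    "Jordan_Normal_Form.Spectral_Radius"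
    "Graph_Theory.Digraph_Component"
    "Graph_Theory.Kuratowski"
begin

text \<open>
  Finite simple graphs are the locale \<open>graph\<close> of Graph_Theory: finite loop-free symmetric digraphs
  without parallel arcs.  An undirected edge \<open>uv\<close> is thus a pair of opposite arcs, and has to be
  counted once, as the set \<open>{u, v}\<close>.
\<close>

definition edge_set :: "('a, 'b) pre_digraph \<Rightarrow> 'a set set" where
  "edge_set G = {{u, v} | u v. u \<rightarrow>\<^bsub>G\<^esub> v}"

definition neighborhood :: "('a, 'b) pre_digraph \<Rightarrow> 'a \<Rightarrow> 'a set" where
  "neighborhood G v = {u. v \<rightarrow>\<^bsub>G\<^esub> u}"

definition closed_neighborhood :: "('a, 'b) pre_digraph \<Rightarrow> 'a \<Rightarrow> 'a set" where
  "closed_neighborhood G v = insert v (neighborhood G v)"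

definition delete_verts :: "('a, 'b) pre_digraph \<Rightarrow> 'a set \<Rightarrow> ('a, 'b) pre_digraph" where
  "delete_verts G S = G \<restriction> (verts G - S)"

definition no_isolated_verts :: "('a, 'b) pre_digraph \<Rightarrow> bool" where
  "no_isolated_verts G \<longleftrightarrow> (\<forall>v \<in> verts G. neighborhood G v \<noteq> {})"

text \<open>Only meaningful for graphs with at least one edge, since \<open>Max {}\<close> is unspecified.\<close>

definition booksize :: "('a, 'b) pre_digraph \<Rightarrow> nat" where
  "booksize G = Max {card (neighborhood G u \<inter> neighborhood G v) | u v. u \<rightarrow>\<^bsub>G\<^esub> v}"

text \<open>
  Copies of \<open>K\<^sub>n\<close> in \<open>G\<close>, as (not necessarily induced) subgraphs; those for \<open>n = 3\<close> are the
  triangles of \<open>G\<close>.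
\<close>

definition complete_subgraphs :: "nat \<Rightarrow> ('a, 'b) pre_digraph \<Rightarrow> ('a, 'b) pre_digraph set" where
  "complete_subgraphs n G = {H. subgraph H G \<and> complete_digraph n H}"

definition complete_free :: "nat \<Rightarrow> ('a, 'b) pre_digraph \<Rightarrow> bool" where
  "complete_free n G \<longleftrightarrow> complete_subgraphs n G = {}"

definition triangles_on_edge :: "('a, 'b) pre_digraph \<Rightarrow> 'a \<Rightarrow> 'a \<Rightarrow> ('a, 'b) pre_digraph set" where
  "triangles_on_edge G u v = {H \<in> complete_subgraphs 3 G. u \<rightarrow>\<^bsub>H\<^esub> v}"

definition adjacency_matrix :: "('a, 'b) pre_digraph \<Rightarrow> 'a list \<Rightarrow> complex mat" where
  "adjacency_matrix G vs =
     mat (length vs) (length vs) (\<lambda>(i, j). if vs ! i \<rightarrow>\<^bsub>G\<^esub> vs ! j then 1 else 0)"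

text \<open>
  The adjacency matrix needs an enumeration of the vertices.  The spectral radius does not depend
  on it, since two enumerations give matrices conjugate by a permutation matrix.
\<close>

definition graph_spectral_radius :: "('a, 'b) pre_digraph \<Rightarrow> real" where
  "graph_spectral_radius G =
     spectral_radius (adjacency_matrix G (SOME vs. distinct vs \<and> set vs = verts G))"

end

theory Submission
  imports Defs "HOL-Analysis.Convex"
begin

text \<open>
  Let \<open>x \<ge> 0\<close> be an eigenvector for \<open>\<lambda>\<close> with \<open>\<Sum>x\<^sub>v = 1\<close>, let \<open>t\<close> be the number of triangles and
  \<open>\<tau> = \<Sum>x\<^sub>v t\<^sub>v\<close>, where \<open>t\<^sub>v\<close> counts the triangles at \<open>v\<close>.  For a triangle \<open>T\<close> and a vertex \<open>z\<close>, the
  number of vertices of \<open>T\<close> adjacent to \<open>z\<close> is at most one plus the number of edges of \<open>T\<close> with both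
  ends adjacent to \<open>z\<close>, with equality unless \<open>z\<close> is adjacent to all or none of \<open>T\<close>.  Summing over
  \<open>T\<close>, and over \<open>z\<close> with weight \<open>x\<^sub>z\<close>, gives \<open>(\<lambda> - \<beta>)\<tau> \<le> t\<close>.  Every triangle also has an edge inside
  \<open>N(z)\<close> or inside its complement, and averaging over \<open>z\<close> gives \<open>t \<le> \<beta>(m - \<lambda>\<^sup>2 + 2\<tau>)\<close>.  Together
  with \<open>3t \<le> \<beta>m\<close> these yield \<open>\<beta> \<ge> \<lambda> - 2m/(3\<lambda>)\<close> when \<open>\<lambda>\<^sup>2 > m\<close>, and equality forces every edge to lie in
  exactly \<open>\<beta>\<close> triangles and every \<open>z\<close> with \<open>x\<^sub>z > 0\<close> to be adjacent to one or two vertices of every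
  triangle.  In that case no eigenvector \<open>x \<ge> 0\<close> vanishes anywhere, so that \<open>G\<close> is connected.
\<close>

section \<open>A nonnegative eigenvector for the spectral radius\<close>

definition mat_act :: "nat \<Rightarrow> (nat \<Rightarrow> nat \<Rightarrow> real) \<Rightarrow> (nat \<Rightarrow> real) \<Rightarrow> nat \<Rightarrow> real" where
  "mat_act n a y = (\<lambda>i. \<Sum>j<n. a i j * y j)"

definition dot :: "nat \<Rightarrow> (nat \<Rightarrow> real) \<Rightarrow> (nat \<Rightarrow> real) \<Rightarrow> real" where
  "dot n y z = (\<Sum>i<n. y i * z i)"

text \<open>\<open>spectral_radius\<close> belongs to complex matrices, while the estimates below
  use real functions on indices; this embedding links the two.\<close>

definition complex_mat :: "nat \<Rightarrow> (nat \<Rightarrow> nat \<Rightarrow> real) \<Rightarrow> complex mat" where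
  "complex_mat n a = mat n n (\<lambda>(i, j). complex_of_real (a i j))"

lemma complex_mat_carrier [simp]: "complex_mat n a \<in> carrier_mat n n"
  by (simp add: complex_mat_def)

lemma dot_self_nonneg: "0 \<le> dot n y y"
  by (simp add: dot_def sum_nonneg)

lemma dot_Cauchy_Schwarz: "(dot n y z)\<^sup>2 \<le> dot n y y * dot n z z"
  unfolding dot_def using Cauchy_Schwarz_ineq_sum[of y z "{..<n}"]
  by (simp add: power2_eq_square)

lemma dot_mat_act_symmetric:
  assumes "\<And>i j. a i j = a j i"
  shows "dot n (mat_act n a y) z = dot n y (mat_act n a z)"
proof -
  have "dot n (mat_act n a y) z = (\<Sum>i<n. \<Sum>j<n. a i j * y j * z i)"
    by (simp add: dot_def mat_act_def sum_distrib_right)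
  also have "\<dots> = (\<Sum>j<n. \<Sum>i<n. a i j * y j * z i)"
    by (rule sum.swap)
  also have "\<dots> = dot n y (mat_act n a z)"
    using assms by (simp add: dot_def mat_act_def sum_distrib_left mult_ac)
  finally show ?thesis .
qed

lemma dot_funpow_mat_act_symmetric:
  assumes "\<And>i j. a i j = a j i"
  shows "dot n ((mat_act n a ^^ k) y) z = dot n y ((mat_act n a ^^ k) z)"
proof (induction k arbitrary: z)
  case (Suc k)
  have "dot n ((mat_act n a ^^ Suc k) y) z = dot n ((mat_act n a ^^ k) y) (mat_act n a z)"
    by (simp add: dot_mat_act_symmetric assms)
  then show ?case
    using Suc by (simp add: funpow_swap1)
qed simp

lemma complex_mat_mult_vec:
  "complex_mat n a *\<^sub>v vec n (\<lambda>i. complex_of_real (y i)) =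
    vec n (\<lambda>i. complex_of_real (mat_act n a y i))"
  by (rule eq_vecI)
    (auto simp: complex_mat_def mat_act_def scalar_prod_def atLeast0LessThan)

lemma complex_mat_pow_mult_vec:
  "(complex_mat n a ^\<^sub>m k) *\<^sub>v vec n (\<lambda>i. complex_of_real (y i)) =
    vec n (\<lambda>i. complex_of_real ((mat_act n a ^^ k) y i))"
proof (induction k arbitrary: y)
  case 0
  have "dim_row (complex_mat n a) = n" by (simp add: complex_mat_def)
  then show ?case by simp
next
  case (Suc k)
  have "(complex_mat n a ^\<^sub>m Suc k) *\<^sub>v vec n (\<lambda>i. complex_of_real (y i)) =
      (complex_mat n a ^\<^sub>m k) *\<^sub>v (complex_mat n a *\<^sub>v vec n (\<lambda>i. complex_of_real (y i)))"
    by (simp add: assoc_mult_mat_vec[OF pow_carrier_mat[OF complex_mat_carrier] complex_mat_carrier])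
  then show ?case
    using Suc by (simp add: complex_mat_mult_vec funpow_swap1)
qed

text \<open>All powers of a complex matrix of spectral radius below 1 share one entrywise bound
  \<open>c\<close>, so the iterates of a fixed vector stay bounded too.\<close>

lemma funpow_mat_act_bounded:
  assumes "spectral_radius (complex_mat n a) < 1"
  obtains C where "\<And>k i. i < n \<Longrightarrow> \<bar>(mat_act n a ^^ k) y i\<bar> \<le> C"
proof -
  obtain c where c: "\<And>k. norm_bound (complex_mat n a ^\<^sub>m k) c"
    using spectral_radius_jnf_norm_bound_less_1_upper_triangular[OF complex_mat_carrier assms]
    by blast
  have "\<bar>(mat_act n a ^^ k) y i\<bar> \<le> (\<Sum>j<n. c * \<bar>y j\<bar>)" if i: "i < n" for k i
  proof -
    let ?B = "complex_mat n a ^\<^sub>m k"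
    have B: "?B \<in> carrier_mat n n" by (simp add: pow_carrier_mat)
    have "complex_of_real ((mat_act n a ^^ k) y i) =
        (?B *\<^sub>v vec n (\<lambda>i. complex_of_real (y i))) $ i"
      using i by (simp add: complex_mat_pow_mult_vec)
    also have "\<dots> = (\<Sum>j<n. ?B $$ (i, j) * complex_of_real (y j))"
      using i carrier_matD[OF B] by (simp add: scalar_prod_def atLeast0LessThan)
    finally have "\<bar>(mat_act n a ^^ k) y i\<bar> = norm (\<Sum>j<n. ?B $$ (i, j) * complex_of_real (y j))"
      by (metis norm_of_real)
    also have "\<dots> \<le> (\<Sum>j<n. norm (?B $$ (i, j) * complex_of_real (y j)))"
      by (rule norm_sum)
    also have "\<dots> \<le> (\<Sum>j<n. c * \<bar>y j\<bar>)"
    proof (rule sum_mono)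
      fix j assume "j \<in> {..<n}"
      then have "norm (?B $$ (i, j)) \<le> c"
        using c[of k] i unfolding norm_bound_def carrier_matD[OF B] by blast
      then show "norm (?B $$ (i, j) * complex_of_real (y j)) \<le> c * \<bar>y j\<bar>"
        unfolding norm_mult norm_of_real by (rule mult_right_mono) simp
    qed
    finally show ?thesis .
  qed
  then show ?thesis using that by blast
qed

text \<open>If the form exceeded \<open>dot n y y\<close>, then by Cauchy--Schwarz the numbers \<open>\<langle>y, a\<^bsup>2^k\<^esup> y\<rangle>\<close> would
  grow like \<open>c\<^bsup>2^k\<^esup>\<close> with \<open>c > 1\<close>.\<close>

lemma quadratic_form_le_if_spectral_radius_less_1:
  assumes sym: "\<And>i j. a i j = a j i"
    and sr: "spectral_radius (complex_mat n a) < 1"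
  shows "dot n y (mat_act n a y) \<le> dot n y y"
proof (rule ccontr)
  assume "\<not> ?thesis"
  then have gt: "dot n y (mat_act n a y) > dot n y y" by simp
  define q where "q k = dot n y ((mat_act n a ^^ k) y)" for k
  have q0: "q 0 > 0"
  proof -
    have "q 0 \<noteq> 0"
    proof
      assume "q 0 = 0"
      then have "\<forall>i<n. y i = 0"
        by (auto simp: q_def dot_def sum_nonneg_eq_0_iff)
      then show False using gt by (simp add: dot_def)
    qed
    then show ?thesis using dot_self_nonneg[of n y] by (simp add: q_def)
  qed
  define c where "c = q 1 / q 0"
  have c: "c > 1" using gt q0 by (simp add: c_def q_def)
  \<comment> \<open>Symmetry moves half of the \<open>2 * k\<close> factors to the left argument, so
    \<open>q (2 * k)\<close> is the squared norm of the \<open>k\<close>-th iterate.\<close>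
  have double: "(q k)\<^sup>2 \<le> q 0 * q (2 * k)" for k
  proof -
    have "q (2 * k) = dot n ((mat_act n a ^^ k) y) ((mat_act n a ^^ k) y)"
      using dot_funpow_mat_act_symmetric[OF sym]
      by (simp add: q_def mult_2 funpow_add)
    then show ?thesis
      using dot_Cauchy_Schwarz[of n y "(mat_act n a ^^ k) y"] by (simp add: q_def)
  qed
  have growth: "q 0 * c ^ (2 ^ k) \<le> q (2 ^ k)" for k
  proof (induction k)
    case 0
    then show ?case using q0 by (simp add: c_def)
  next
    case (Suc k)
    have "q 0 * (q 0 * c ^ (2 ^ Suc k)) = (q 0 * c ^ (2 ^ k))\<^sup>2"
      by (simp add: power_mult_distrib power2_eq_square power_add mult_2)
    also have "\<dots> \<le> (q (2 ^ k))\<^sup>2"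
      using Suc q0 c by (intro power_mono) auto
    also have "\<dots> \<le> q 0 * q (2 ^ Suc k)"
      using double[of "2 ^ k"] by simp
    finally show ?case using q0 by simp
  qed
  obtain C where C: "\<And>k i. i < n \<Longrightarrow> \<bar>(mat_act n a ^^ k) y i\<bar> \<le> C"
    using funpow_mat_act_bounded[OF sr] by blast
  have bounded: "q k \<le> (\<Sum>i<n. \<bar>y i\<bar> * C)" for k
    unfolding q_def dot_def
  proof (rule sum_mono)
    fix i assume "i \<in> {..<n}"
    have "y i * (mat_act n a ^^ k) y i \<le> \<bar>y i\<bar> * \<bar>(mat_act n a ^^ k) y i\<bar>"
      by (metis abs_ge_self abs_mult)
    also have "\<dots> \<le> \<bar>y i\<bar> * C"
      using C \<open>i \<in> {..<n}\<close> by (intro mult_left_mono) auto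
    finally show "y i * (mat_act n a ^^ k) y i \<le> \<bar>y i\<bar> * C" .
  qed
  obtain k where k: "(\<Sum>i<n. \<bar>y i\<bar> * C) / q 0 < c ^ k"
    using real_arch_pow[OF c] by blast
  have "c ^ k \<le> c ^ (2 ^ k)"
    using c by (intro power_increasing) auto
  then have "(\<Sum>i<n. \<bar>y i\<bar> * C) < q 0 * c ^ (2 ^ k)"
    using k q0 by (simp add: field_simps) (smt (verit) mult_left_mono)
  then show False using growth[of k] bounded[of "2 ^ k"] by linarith
qed

text \<open>Dividing the matrix by any \<open>r\<close> above its spectral radius reduces the claim
  to the previous lemma; then \<open>r\<close> decreases to the spectral radius.\<close>

lemma quadratic_form_le_spectral_radius:
  assumes sym: "\<And>i j. a i j = a j i" and n: "n > 0"
  shows "dot n y (mat_act n a y) \<le> spectral_radius (complex_mat n a) * dot n y y"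
proof -
  let ?\<rho> = "spectral_radius (complex_mat n a)"
  have \<rho>: "?\<rho> \<ge> 0"
    using spectral_radius_mem_max(1)[OF complex_mat_carrier n, of a] by auto
  have le: "dot n y (mat_act n a y) \<le> r * dot n y y" if r: "r > ?\<rho>" for r
  proof -
    have r0: "r > 0" using r \<rho> by simp
    define b where "b i j = a i j / r" for i j
    have A: "complex_mat n a = complex_of_real r \<cdot>\<^sub>m complex_mat n b"
      using r0 by (intro eq_matI) (auto simp: complex_mat_def b_def)
    obtain e where e: "eigenvalue (complex_mat n b) e"
        "spectral_radius (complex_mat n b) = norm e"
      using spectral_radius_mem_max(1)[OF complex_mat_carrier n, of b] by (auto simp: spectrum_def)
    obtain v where v: "v \<in> carrier_vec n" "v \<noteq> 0\<^sub>v n" "complex_mat n b *\<^sub>v v = e \<cdot>\<^sub>v v"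
      using e(1) by (auto simp: eigenvalue_def eigenvector_def complex_mat_def)
    \<comment> \<open>An eigenvalue \<open>e\<close> of the scaled matrix makes \<open>r * e\<close>
      one of the original, which bounds the modulus of \<open>e\<close> below 1.\<close>
    have "complex_mat n a *\<^sub>v v = complex_of_real r \<cdot>\<^sub>v (complex_mat n b *\<^sub>v v)"
      using v(1) unfolding A by (intro eq_vecI) (auto simp: complex_mat_def)
    also have "\<dots> = (complex_of_real r * e) \<cdot>\<^sub>v v"
      using v by (simp add: smult_smult_assoc)
    finally have "eigenvalue (complex_mat n a) (complex_of_real r * e)"
      using v unfolding eigenvalue_def eigenvector_def
      by (intro exI[of _ v]) (auto simp: complex_mat_def)
    then have "norm (complex_of_real r * e) \<le> ?\<rho>"
      by (intro spectral_radius_mem_max(2)[OF complex_mat_carrier n]) (auto simp: spectrum_def)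
    then have "r * norm e < r * 1" using r r0 by (simp only: norm_mult norm_of_real)
    then have "spectral_radius (complex_mat n b) < 1" using r0 e by simp
    moreover have "\<And>i j. b i j = b j i" using sym by (simp add: b_def)
    ultimately have "dot n y (mat_act n b y) \<le> dot n y y"
      by (rule quadratic_form_le_if_spectral_radius_less_1[rotated])
    moreover have "mat_act n b y = (\<lambda>i. mat_act n a y i / r)"
      by (simp add: mat_act_def b_def sum_divide_distrib)
    ultimately have "dot n y (mat_act n a y) / r \<le> dot n y y"
      by (simp add: dot_def sum_divide_distrib)
    then show ?thesis using r0 by (simp add: field_simps)
  qed
  show ?thesis
  proof (rule tendsto_lowerbound)
    show "((\<lambda>r. r * dot n y y) \<longlongrightarrow> ?\<rho> * dot n y y) (at_right ?\<rho>)"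
      by (intro tendsto_intros)
    show "\<forall>\<^sub>F r in at_right ?\<rho>. dot n y (mat_act n a y) \<le> r * dot n y y"
      using le by (auto simp: eventually_at_right_less eventually_at_filter)
  qed simp
qed

text \<open>The entrywise modulus of an eigenvector of largest modulus maximises the Rayleigh quotient,
  hence is itself an eigenvector.\<close>

lemma nonneg_eigenvector_spectral_radius:
  assumes sym: "\<And>i j. a i j = a j i" and nonneg: "\<And>i j. 0 \<le> a i j" and n: "n > 0"
  obtains y where "\<And>i. i < n \<Longrightarrow> 0 \<le> y i" and "\<exists>i<n. y i \<noteq> 0"
    and "\<And>i. i < n \<Longrightarrow> (\<Sum>j<n. a i j * y j) = spectral_radius (complex_mat n a) * y i"
proof -
  let ?\<rho> = "spectral_radius (complex_mat n a)"
  obtain e where e: "eigenvalue (complex_mat n a) e" "?\<rho> = norm e"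
    using spectral_radius_mem_max(1)[OF complex_mat_carrier n, of a] by (auto simp: spectrum_def)
  obtain v where v: "v \<in> carrier_vec n" "v \<noteq> 0\<^sub>v n" "complex_mat n a *\<^sub>v v = e \<cdot>\<^sub>v v"
    using e(1) by (auto simp: eigenvalue_def eigenvector_def complex_mat_def)
  define y where "y i = norm (v $ i)" for i
  have ev: "(\<Sum>j<n. complex_of_real (a i j) * v $ j) = e * v $ i" if "i < n" for i
  proof -
    have "(complex_mat n a *\<^sub>v v) $ i = (\<Sum>j<n. complex_of_real (a i j) * v $ j)"
      using that v(1) by (auto simp: complex_mat_def scalar_prod_def atLeast0LessThan)
    then show ?thesis using that v by simp
  qed
  have sup: "?\<rho> * y i \<le> mat_act n a y i" if "i < n" for i
  proof -
    have "?\<rho> * y i = norm (\<Sum>j<n. complex_of_real (a i j) * v $ j)"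
      using that by (simp add: ev e(2) y_def norm_mult)
    also have "\<dots> \<le> (\<Sum>j<n. norm (complex_of_real (a i j) * v $ j))" by (rule norm_sum)
    also have "\<dots> = mat_act n a y i" by (simp add: mat_act_def y_def norm_mult nonneg)
    finally show ?thesis .
  qed
  \<comment> \<open>\<open>g\<close> is the defect in the eigenvalue equation. Since
    \<open>g\<close> is nonpositive and \<open>Q y\<close> equals \<open>dot n y g\<close>, the form
    \<open>Q\<close> attains its minimum 0 at \<open>y\<close>.\<close>
  define g where "g i = ?\<rho> * y i - mat_act n a y i" for i
  define Q where "Q z = ?\<rho> * dot n z z - dot n z (mat_act n a z)" for z
  have Q: "Q z \<ge> 0" for z
    using quadratic_form_le_spectral_radius[OF sym n, of z] by (simp add: Q_def)
  have "dot n y g \<le> 0"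
    unfolding dot_def using sup by (intro sum_nonpos mult_nonneg_nonpos) (auto simp: g_def y_def)
  moreover have "Q y = dot n y g"
    by (simp add: Q_def g_def dot_def sum_subtractf sum_distrib_left algebra_simps)
  ultimately have Qy: "Q y = 0" using Q[of y] by linarith
  \<comment> \<open>The linear term in \<open>t\<close> is the derivative of \<open>Q\<close> at its
    minimiser \<open>y\<close> along \<open>g\<close>, so it has to vanish.\<close>
  have expand: "Q (\<lambda>i. y i - t * g i) = t\<^sup>2 * Q g - 2 * t * dot n g g" for t
  proof -
    have 1: "mat_act n a (\<lambda>i. y i - t * g i) = (\<lambda>i. mat_act n a y i - t * mat_act n a g i)"
      by (simp add: mat_act_def algebra_simps sum_subtractf sum_distrib_left)
    have 2: "dot n y (mat_act n a g) = dot n (mat_act n a y) g"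
      using dot_mat_act_symmetric[OF sym] by simp
    have 3: "dot n g g = ?\<rho> * dot n y g - dot n (mat_act n a y) g"
      unfolding dot_def sum_distrib_left sum_subtractf[symmetric]
      by (rule sum.cong) (simp_all add: g_def algebra_simps)
    have "Q (\<lambda>i. y i - t * g i) = Q y + t\<^sup>2 * Q g
        - t * (2 * ?\<rho> * dot n y g - dot n y (mat_act n a g) - dot n (mat_act n a y) g)"
      unfolding Q_def 1
      by (simp add: dot_def algebra_simps sum_subtractf sum.distrib sum_distrib_left power2_eq_square)
    moreover have "2 * ?\<rho> * dot n y g - dot n y (mat_act n a g) - dot n (mat_act n a y) g = 2 * dot n g g"
      using 2 3 by linarith
    ultimately show ?thesis using Qy by (simp add: mult_ac)
  qed
  have "dot n g g \<le> 0"
  proof (rule ccontr)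
    assume "\<not> ?thesis"
    then have G: "dot n g g > 0" by simp
    \<comment> \<open>The summand 1 keeps the denominator positive when \<open>Q g = 0\<close>; this
      \<open>t\<close> is small enough for the linear term to dominate.\<close>
    define t where "t = dot n g g / (Q g + 1)"
    have t: "t > 0" using G Q[of g] by (simp add: t_def add_nonneg_pos)
    have "t * Q g < 2 * dot n g g"
    proof -
      have "t * (Q g + 1) = dot n g g" using Q[of g] by (simp add: t_def)
      then show ?thesis using t G by (simp add: algebra_simps)
    qed
    then have "t * (t * Q g) < t * (2 * dot n g g)" using t by simp
    then show False
      using Q[of "\<lambda>i. y i - t * g i"] unfolding expand by (simp add: power2_eq_square)
  qed
  then have "dot n g g = 0" using dot_self_nonneg[of n g] by linarith
  then have "\<And>i. i < n \<Longrightarrow> g i = 0"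
    by (auto simp: dot_def sum_nonneg_eq_0_iff)
  then have "(\<Sum>j<n. a i j * y j) = ?\<rho> * y i" if "i < n" for i
    using that by (simp add: g_def mat_act_def)
  moreover have "\<exists>i<n. y i \<noteq> 0"
  proof (rule ccontr)
    assume "\<not> ?thesis"
    then have "v = 0\<^sub>v n" using v(1) by (intro eq_vecI) (auto simp: y_def)
    then show False using v(2) by simp
  qed
  ultimately show ?thesis using that[of y] by (simp add: y_def)
qed

section \<open>Weighted triangle counts\<close>

lemma sum_swap_inner3:
  fixes f :: "'a \<Rightarrow> 'a \<Rightarrow> 'a \<Rightarrow> real"
  shows "(\<Sum>u\<in>V. \<Sum>v\<in>V. \<Sum>w\<in>V. f u v w) = (\<Sum>u\<in>V. \<Sum>v\<in>V. \<Sum>w\<in>V. f u w v)"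
  by (rule sum.cong[OF refl sum.swap])

lemma sum_swap_outer3:
  fixes f :: "'a \<Rightarrow> 'a \<Rightarrow> 'a \<Rightarrow> real"
  shows "(\<Sum>u\<in>V. \<Sum>v\<in>V. \<Sum>w\<in>V. f u v w) = (\<Sum>u\<in>V. \<Sum>v\<in>V. \<Sum>w\<in>V. f v u w)"
  by (rule sum.swap)

text \<open>With total weight 1, sums against \<open>x\<close> are averages over a random vertex.
  Zero weights are allowed, so that eigenvectors supported on a single component are
  covered.\<close>

locale adjacency_eigenvector =
  fixes V :: "'a set" and adj :: "'a \<Rightarrow> 'a \<Rightarrow> bool" and x :: "'a \<Rightarrow> real" and lam :: real
  assumes finite_V: "finite V"
    and adj_sym: "adj u v \<Longrightarrow> adj v u"
    and x_nonneg: "v \<in> V \<Longrightarrow> 0 \<le> x v"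
    and x_sum: "(\<Sum>v\<in>V. x v) = 1"
    and eigen: "u \<in> V \<Longrightarrow> (\<Sum>v\<in>V. of_bool (adj u v) * x v) = lam * x u"
begin

definition a :: "'a \<Rightarrow> 'a \<Rightarrow> real" where
  "a u v = of_bool (adj u v)"

definition tri :: "'a \<Rightarrow> 'a \<Rightarrow> 'a \<Rightarrow> real" where
  "tri u v w = a u v * a v w * a u w"

definition codeg :: "'a \<Rightarrow> 'a \<Rightarrow> real" where
  "codeg u v = (\<Sum>w\<in>V. a u w * a v w)"

definition wcodeg :: "'a \<Rightarrow> 'a \<Rightarrow> real" where
  "wcodeg u v = (\<Sum>w\<in>V. a u w * a v w * x w)"

text \<open>In terms of the numbers \<open>m\<close> of edges, \<open>t\<close> of triangles and \<open>t\<^sub>v\<close> of triangles at \<open>v\<close>, we have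
  \<open>M = 2m\<close>, \<open>S = 6t\<close> and \<open>R = 2 \<Sum>\<^sub>v x\<^sub>v t\<^sub>v\<close>.\<close>

definition M :: real where "M = (\<Sum>u\<in>V. \<Sum>v\<in>V. a u v)"
definition S :: real where "S = (\<Sum>u\<in>V. \<Sum>v\<in>V. a u v * codeg u v)"
definition R :: real where "R = (\<Sum>u\<in>V. \<Sum>v\<in>V. a u v * wcodeg u v)"
text \<open>Twice the sum, over triangles and their edges, of the weight of the vertices adjacent to
  both ends of the edge.\<close>

definition P :: real where "P = (\<Sum>u\<in>V. \<Sum>v\<in>V. a u v * codeg u v * wcodeg u v)"

definition all_or_none :: "'a \<Rightarrow> 'a \<Rightarrow> 'a \<Rightarrow> 'a \<Rightarrow> real" where
  "all_or_none u v w z =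
    (1 - a u z) * (1 - a v z) * (1 - a w z) + a u z * a v z * a w z"

text \<open>The common slack of the two triangle inequalities, counted over ordered triangles; it is
  carried along exactly so that the equality case can be read off.\<close>

definition N :: real where
  "N = (\<Sum>u\<in>V. \<Sum>v\<in>V. \<Sum>w\<in>V. tri u v w * (\<Sum>z\<in>V. x z * all_or_none u v w z))"

section \<open>Symmetries of triangle sums and the identity for \<open>N\<close>\<close>

lemma a_sym: "a u v = a v u"
  using adj_sym by (auto simp: a_def)

lemma a_nonneg [simp]: "0 \<le> a u v"
  and a_le_1 [simp]: "a u v \<le> 1"
  by (auto simp: a_def)

lemma a_eigen: "u \<in> V \<Longrightarrow> (\<Sum>v\<in>V. a u v * x v) = lam * x u"
  using eigen by (simp add: a_def)

lemma tri_nonneg: "0 \<le> tri u v w"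
  by (simp add: tri_def)

lemma all_or_none_nonneg: "0 \<le> all_or_none u v w z"
  by (simp add: all_or_none_def)

lemma tri_swap12: "tri u v w = tri v u w"
  and tri_swap23: "tri u v w = tri u w v"
  using a_sym by (simp_all add: tri_def mult_ac)

lemma wcodeg_nonneg: "0 \<le> wcodeg u v"
  by (auto simp: wcodeg_def intro!: sum_nonneg mult_nonneg_nonneg x_nonneg)

lemma sum_tri: "(\<Sum>w\<in>V. tri u v w) = a u v * codeg u v"
  by (simp add: tri_def codeg_def sum_distrib_left mult_ac)

lemma S_tri: "S = (\<Sum>u\<in>V. \<Sum>v\<in>V. \<Sum>w\<in>V. tri u v w)"
  by (simp add: S_def sum_tri)

lemma R_tri3: "R = (\<Sum>u\<in>V. \<Sum>v\<in>V. \<Sum>w\<in>V. tri u v w * x w)"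
  by (simp add: R_def tri_def wcodeg_def sum_distrib_left mult_ac)

text \<open>By symmetry of \<open>tri\<close> the weight may sit at any corner of an ordered
  triangle. Likewise \<open>P\<close> may use any of its three edges.\<close>

lemma R_tri2: "R = (\<Sum>u\<in>V. \<Sum>v\<in>V. \<Sum>w\<in>V. tri u v w * x v)"
  unfolding R_tri3 by (subst sum_swap_inner3) (simp add: tri_swap23)

lemma R_tri1: "R = (\<Sum>u\<in>V. \<Sum>v\<in>V. \<Sum>w\<in>V. tri u v w * x u)"
  unfolding R_tri2 by (subst sum_swap_outer3) (simp add: tri_swap12)

lemma R_codeg: "R = (\<Sum>u\<in>V. \<Sum>v\<in>V. a u v * codeg u v * x u)"
  by (simp add: R_tri1 sum_distrib_right[symmetric] sum_tri)

lemma P_tri12: "P = (\<Sum>u\<in>V. \<Sum>v\<in>V. \<Sum>w\<in>V. tri u v w * wcodeg u v)"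
  by (simp add: P_def sum_distrib_right[symmetric] sum_tri)

lemma P_tri13: "P = (\<Sum>u\<in>V. \<Sum>v\<in>V. \<Sum>w\<in>V. tri u v w * wcodeg u w)"
  unfolding P_tri12 by (subst sum_swap_inner3) (simp add: tri_swap23)

lemma P_tri23: "P = (\<Sum>u\<in>V. \<Sum>v\<in>V. \<Sum>w\<in>V. tri u v w * wcodeg v w)"
  unfolding P_tri13 by (subst sum_swap_outer3) (simp add: tri_swap12)

text \<open>The cubic terms of the two products cancel. What remains is linear, evaluated by the
  eigenvalue equation, or quadratic, giving \<open>wcodeg\<close> of the three edges.\<close>

lemma sum_all_or_none:
  assumes "u \<in> V" "v \<in> V" "w \<in> V"
  shows "(\<Sum>z\<in>V. x z * all_or_none u v w z) =
    1 - lam * (x u + x v + x w) + (wcodeg u v + wcodeg v w + wcodeg u w)"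
proof -
  have "(\<Sum>z\<in>V. x z * all_or_none u v w z) =
      (\<Sum>z\<in>V. x z - a u z * x z - a v z * x z - a w z * x z
        + a u z * a v z * x z + a v z * a w z * x z + a u z * a w z * x z)"
    by (rule sum.cong) (simp_all add: all_or_none_def algebra_simps)
  also have "\<dots> = 1 - lam * x u - lam * x v - lam * x w
      + wcodeg u v + wcodeg v w + wcodeg u w"
    using assms by (simp add: sum.distrib sum_subtractf x_sum a_eigen wcodeg_def)
  finally show ?thesis by (simp add: algebra_simps)
qed

text \<open>Each corner of a triangle contributes one \<open>R\<close> and each edge one
  \<open>P\<close>. Combined with \<open>0 \<le> N\<close> and an upper bound on \<open>P\<close>,
  this is the first triangle inequality.\<close>

lemma N_eq: "N = S - 3 * lam * R + 3 * P"
proof -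
  have "N = (\<Sum>u\<in>V. \<Sum>v\<in>V. \<Sum>w\<in>V. tri u v w
      - lam * (tri u v w * x u) - lam * (tri u v w * x v) - lam * (tri u v w * x w)
      + tri u v w * wcodeg u v + tri u v w * wcodeg v w + tri u v w * wcodeg u w)"
    unfolding N_def
    by (intro sum.cong refl) (simp add: sum_all_or_none algebra_simps)
  also have "\<dots> = S - lam * R - lam * R - lam * R + P + P + P"
    by (simp only: sum.distrib sum_subtractf sum_distrib_left[symmetric] S_tri[symmetric]
        R_tri1[symmetric] R_tri2[symmetric] R_tri3[symmetric]
        P_tri12[symmetric] P_tri13[symmetric] P_tri23[symmetric])
  finally show ?thesis by simp
qed

lemma N_nonneg: "0 \<le> N"
  unfolding N_def
  by (intro sum_nonneg mult_nonneg_nonneg tri_nonneg x_nonneg all_or_none_nonneg)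

lemma N_eq_0_iff:
  "N = 0 \<longleftrightarrow> (\<forall>u\<in>V. \<forall>v\<in>V. \<forall>w\<in>V. \<forall>z\<in>V. tri u v w * (x z * all_or_none u v w z) = 0)"
proof -
  have nn: "0 \<le> (\<Sum>z\<in>V. x z * all_or_none u v w z)" for u v w
    by (intro sum_nonneg mult_nonneg_nonneg x_nonneg all_or_none_nonneg)
  have nn': "0 \<le> tri u v w * (\<Sum>z\<in>V. x z * all_or_none u v w z)" for u v w
    by (intro mult_nonneg_nonneg tri_nonneg nn)
  have z: "(\<Sum>z\<in>V. x z * all_or_none u v w z) = 0 \<longleftrightarrow> (\<forall>z\<in>V. x z * all_or_none u v w z = 0)" for u v w
    by (intro sum_nonneg_eq_0_iff finite_V mult_nonneg_nonneg x_nonneg all_or_none_nonneg)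
  show ?thesis
    unfolding N_def
    by (simp only: sum_nonneg_eq_0_iff[OF finite_V] sum_nonneg nn' mult_eq_0_iff z)
      (auto simp: z)
qed

text \<open>The eigenvalue equations are added up. The second form says that \<open>lam\<close> is
  the average degree with respect to the weights \<open>x\<close>.\<close>

lemma sum_a_x: "(\<Sum>u\<in>V. \<Sum>v\<in>V. a u v * x v) = lam"
  and sum_a_x': "(\<Sum>u\<in>V. \<Sum>v\<in>V. a u v * x u) = lam"
proof -
  show *: "(\<Sum>u\<in>V. \<Sum>v\<in>V. a u v * x v) = lam"
    by (simp add: a_eigen sum_distrib_left[symmetric] x_sum)
  show "(\<Sum>u\<in>V. \<Sum>v\<in>V. a u v * x u) = lam"
    by (subst sum.swap) (use * in \<open>simp add: a_sym\<close>)
qed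

lemma sum_a_lam_x: "(\<Sum>u\<in>V. \<Sum>v\<in>V. a u v * (lam * (x u + x v))) = 2 * lam\<^sup>2"
proof -
  have "(\<Sum>u\<in>V. \<Sum>v\<in>V. a u v * (lam * (x u + x v))) =
      lam * (\<Sum>u\<in>V. \<Sum>v\<in>V. a u v * x u) + lam * (\<Sum>u\<in>V. \<Sum>v\<in>V. a u v * x v)"
    by (simp add: sum_distrib_left sum.distrib algebra_simps)
  then show ?thesis by (simp add: sum_a_x sum_a_x' power2_eq_square)
qed

text \<open>For \<open>c = 1\<close> the bracket is the weight of the vertices adjacent to neither
  end of \<open>uv\<close>; for \<open>c = 2\<close> the vertices adjacent to both ends are
  included.\<close>

lemma sum_a_minus: "(\<Sum>u\<in>V. \<Sum>v\<in>V. a u v * (1 - lam * (x u + x v) + c * wcodeg u v)) =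
    M - 2 * lam\<^sup>2 + c * R"
proof -
  have "(\<Sum>u\<in>V. \<Sum>v\<in>V. a u v * (1 - lam * (x u + x v) + c * wcodeg u v)) =
     (\<Sum>u\<in>V. \<Sum>v\<in>V. a u v - a u v * (lam * (x u + x v)) + c * (a u v * wcodeg u v))"
    by (simp add: algebra_simps)
  also have "\<dots> = M - 2 * lam\<^sup>2 + c * R"
    by (simp only: sum.distrib sum_subtractf sum_a_lam_x sum_distrib_left[symmetric]
        M_def[symmetric] R_def[symmetric])
  finally show ?thesis .
qed

text \<open>Nosal's bound \<open>\<lambda>\<^sup>2 \<le> m\<close> for triangle-free graphs is the case \<open>R = 0\<close>.\<close>

lemma R_ge: "2 * lam\<^sup>2 - M \<le> R"
proof -
  have "0 \<le> 1 - lam * (x u + x v) + wcodeg u v" if "u \<in> V" "v \<in> V" for u v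
  proof -
    have "1 - lam * (x u + x v) + wcodeg u v = 1 - lam * x u - lam * x v + wcodeg u v"
      by (simp add: algebra_simps)
    also have "\<dots> = (\<Sum>z\<in>V. x z - a u z * x z - a v z * x z + a u z * a v z * x z)"
      using that by (simp add: sum.distrib sum_subtractf x_sum a_eigen wcodeg_def)
    also have "\<dots> = (\<Sum>z\<in>V. x z * ((1 - a u z) * (1 - a v z)))"
      by (simp add: algebra_simps)
    also have "\<dots> \<ge> 0"
      by (intro sum_nonneg mult_nonneg_nonneg x_nonneg) auto
    finally show ?thesis .
  qed
  then have "0 \<le> (\<Sum>u\<in>V. \<Sum>v\<in>V. a u v * (1 - lam * (x u + x v) + 1 * wcodeg u v))"
    by (intro sum_nonneg mult_nonneg_nonneg) auto
  then show ?thesis unfolding sum_a_minus by simp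
qed

text \<open>Averages over \<open>z\<close> the number of pairs of an ordered triangle and its first
  edge such that this edge does not cross the cut given by the neighbours of
  \<open>z\<close>.\<close>

lemma codeg_one_side:
  "(\<Sum>u\<in>V. \<Sum>v\<in>V. a u v * codeg u v * (1 - lam * (x u + x v) + 2 * wcodeg u v)) =
    S - 2 * lam * R + 2 * P"
proof -
  have R2: "(\<Sum>u\<in>V. \<Sum>v\<in>V. a u v * codeg u v * x v) = R"
    by (simp add: R_tri2 sum_distrib_right[symmetric] sum_tri)
  have "(\<Sum>u\<in>V. \<Sum>v\<in>V. a u v * codeg u v * (1 - lam * (x u + x v) + 2 * wcodeg u v)) =
     (\<Sum>u\<in>V. \<Sum>v\<in>V. a u v * codeg u v - lam * (a u v * codeg u v * x u)
        - lam * (a u v * codeg u v * x v) + 2 * (a u v * codeg u v * wcodeg u v))"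
    by (simp add: algebra_simps)
  also have "\<dots> = S - lam * R - lam * R + 2 * P"
    by (simp only: sum.distrib sum_subtractf sum_distrib_left[symmetric] R2
        S_def[symmetric] R_codeg[symmetric] P_def[symmetric])
  finally show ?thesis by simp
qed

text \<open>The expression is the weight of all \<open>z\<close> adjacent to both or to neither of
  \<open>u\<close> and \<open>v\<close>.\<close>

lemma one_side_nonneg:
  assumes "u \<in> V" "v \<in> V"
  shows "0 \<le> 1 - lam * (x u + x v) + 2 * wcodeg u v"
proof -
  have "1 - lam * (x u + x v) + 2 * wcodeg u v =
      1 - lam * x u - lam * x v + wcodeg u v + wcodeg u v"
    by (simp add: algebra_simps)
  also have "\<dots> = (\<Sum>z\<in>V. x z - a u z * x z - a v z * x z
      + a u z * a v z * x z + a u z * a v z * x z)"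
    by (simp only: sum.distrib sum_subtractf x_sum a_eigen[OF assms(1)] a_eigen[OF assms(2)] wcodeg_def)
  also have "\<dots> = (\<Sum>z\<in>V. x z * ((1 - a u z) * (1 - a v z) + a u z * a v z))"
    by (simp add: algebra_simps)
  also have "\<dots> \<ge> 0"
    by (intro sum_nonneg mult_nonneg_nonneg add_nonneg_nonneg x_nonneg) auto
  finally show ?thesis .
qed

section \<open>Inequalities under an upper bound on codegrees\<close>

context
  fixes b :: real
  assumes codeg_le: "\<And>u v. u \<in> V \<Longrightarrow> v \<in> V \<Longrightarrow> adj u v \<Longrightarrow> codeg u v \<le> b"
begin

lemma a_codeg_le: "u \<in> V \<Longrightarrow> v \<in> V \<Longrightarrow> a u v * codeg u v \<le> a u v * b"
  using codeg_le by (auto simp: a_def)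

lemma S_le: "S \<le> b * M"
proof -
  have "S \<le> (\<Sum>u\<in>V. \<Sum>v\<in>V. a u v * b)"
    unfolding S_def by (intro sum_mono a_codeg_le)
  then show ?thesis by (simp add: M_def sum_distrib_left mult.commute)
qed

lemma P_le: "P \<le> b * R"
proof -
  have "P \<le> (\<Sum>u\<in>V. \<Sum>v\<in>V. a u v * b * wcodeg u v)"
    unfolding P_def by (intro sum_mono mult_right_mono a_codeg_le wcodeg_nonneg)
  then show ?thesis by (simp add: R_def sum_distrib_left mult_ac)
qed

text \<open>Every triangle has an edge that does not cross the cut between the neighbours and the
  non-neighbours of \<open>z\<close>, and three such edges if \<open>z\<close> is adjacent to all or none of its vertices.
  The bound is the average over \<open>z\<close>, weighted by \<open>x\<close>, of the resulting count.\<close>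

lemma S_plus_N_le: "S + 2 * N \<le> 3 * b * (M - 2 * lam\<^sup>2 + 2 * R)"
proof -
  have "S - 2 * lam * R + 2 * P \<le>
      (\<Sum>u\<in>V. \<Sum>v\<in>V. a u v * b * (1 - lam * (x u + x v) + 2 * wcodeg u v))"
    unfolding codeg_one_side[symmetric] by (intro sum_mono mult_right_mono a_codeg_le one_side_nonneg)
  also have "\<dots> = b * (M - 2 * lam\<^sup>2 + 2 * R)"
    unfolding sum_a_minus[symmetric] by (simp add: sum_distrib_left mult_ac)
  \<comment> \<open>By \<open>N_eq\<close>, three times the left-hand side is exactly
    \<open>S + 2 * N\<close>.\<close>
  finally show ?thesis by (simp add: N_eq algebra_simps)
qed

text \<open>The bound \<open>S \<le> b * M\<close> holds term by term, so equality of the sums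
  forces equality on each edge.\<close>

lemma codeg_eq_if_S_eq:
  assumes "S = b * M" "u \<in> V" "v \<in> V" "adj u v"
  shows "codeg u v = b"
proof -
  have nn: "0 \<le> a u v * b - a u v * codeg u v" if "u \<in> V" "v \<in> V" for u v
    using a_codeg_le[OF that] by simp
  have "(\<Sum>u\<in>V. \<Sum>v\<in>V. a u v * b - a u v * codeg u v) = b * M - S"
    by (simp add: M_def S_def sum_subtractf sum_distrib_left mult.commute)
  then have "(\<Sum>u\<in>V. \<Sum>v\<in>V. a u v * b - a u v * codeg u v) = 0"
    using assms(1) by simp
  then have "a u v * b - a u v * codeg u v = 0"
    using assms(2,3) nn by (simp add: sum_nonneg_eq_0_iff[OF finite_V] sum_nonneg)
  then show ?thesis using assms(4) by (simp add: a_def)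
qed

text \<open>Eliminating \<open>R\<close> from \<open>3(\<lambda> - \<beta>)R \<le> S\<close> and \<open>S \<le> 3\<beta>(M - 2\<lambda>\<^sup>2 + 2R)\<close> gives
  \<open>3\<beta>(\<lambda> - \<beta>)(2\<lambda>\<^sup>2 - M) \<le> S(3\<beta> - \<lambda>)\<close>, whose two sides agree for \<open>S = \<beta>M\<close> and the given \<open>\<beta>\<close>.\<close>

lemma extremal:
  assumes M: "0 < M" and lam: "0 < lam" and gt: "M < 2 * lam\<^sup>2"
    and b: "b = lam - M / (3 * lam)"
  shows "0 < b" and "S = b * M" and "N = 0"
proof -
  have bl: "b * lam = lam\<^sup>2 - M / 3" and dl: "3 * (lam - b) * lam = M"
    using lam by (simp_all add: b power2_eq_square field_simps)
  have "0 < b * lam" using bl gt M by linarith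
  then show b0: "0 < b" using lam by (simp add: zero_less_mult_iff)
  define d where "d = lam - b"
  have d0: "0 < d" using M lam by (simp add: d_def b)
  have dM: "3 * d * lam = M" using dl by (simp add: d_def)
  have I: "3 * d * R \<le> S"
    using N_eq N_nonneg P_le by (simp add: d_def algebra_simps)
  have II: "S \<le> 3 * b * (M - 2 * lam\<^sup>2 + 2 * R)"
    using S_plus_N_le N_nonneg by linarith
  \<comment> \<open>Here \<open>M < 2 * lam\<^sup>2\<close> enters: it fixes the sign of the factor
    to be cancelled from the bound on \<open>S\<close>.\<close>
  have k: "3 * b - lam > 0"
  proof -
    have "(3 * b - lam) * lam = 2 * lam\<^sup>2 - M"
      using bl by (simp add: algebra_simps power2_eq_square)
    then have "0 < (3 * b - lam) * lam" using gt by simp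
    then show ?thesis using lam by (simp add: zero_less_mult_iff)
  qed
  have "d * S \<le> d * (3 * b * (M - 2 * lam\<^sup>2 + 2 * R))"
    using II d0 by (intro mult_left_mono) auto
  also have "\<dots> = 3 * b * d * (M - 2 * lam\<^sup>2) + 2 * b * (3 * d * R)"
    by (simp add: algebra_simps)
  also have "\<dots> \<le> 3 * b * d * (M - 2 * lam\<^sup>2) + 2 * b * S"
    using I b0 by (intro add_left_mono mult_left_mono) auto
  finally have "3 * b * d * (2 * lam\<^sup>2 - M) \<le> (3 * b - lam) * S"
    by (simp add: d_def algebra_simps)
  moreover have "3 * b * d * (2 * lam\<^sup>2 - M) = (3 * b - lam) * (b * M)"
  proof -
    have "2 * lam\<^sup>2 - M = (3 * b - lam) * lam"
      using bl by (simp add: algebra_simps power2_eq_square)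
    then have "3 * b * d * (2 * lam\<^sup>2 - M) = (3 * b - lam) * (b * (3 * d * lam))"
      by simp
    then show ?thesis by (simp only: dM)
  qed
  ultimately have "(3 * b - lam) * (b * M) \<le> (3 * b - lam) * S" by simp
  then have "b * M \<le> S" using k by simp
  then show S: "S = b * M" using S_le by simp
  have "3 * d * R \<le> 3 * d * (lam * b)"
    using I S dM by (simp add: mult_ac)
  then have R: "R \<le> lam * b" using d0 by simp
  \<comment> \<open>Putting the bound on \<open>R\<close> back into the second inequality turns its
    right-hand side into \<open>b * M = S\<close>, leaving no room for \<open>N\<close>.\<close>
  have "S + 2 * N \<le> 3 * b * (M - 2 * lam\<^sup>2 + 2 * (lam * b))"
    using S_plus_N_le R b0 by (smt (verit) mult_left_mono)
  also have "M - 2 * lam\<^sup>2 + 2 * (lam * b) = M / 3"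
    using bl by (simp add: mult.commute)
  finally have "N \<le> 0" using S by simp
  then show "N = 0" using N_nonneg by simp
qed

end

section \<open>Structure in the case of equality, and the converse computation\<close>

text \<open>A zero of \<open>x\<close> spreads to all neighbours, hence to all corners of some
  triangle, which exists because \<open>b\<close> is positive. By \<open>sum_all_or_none\<close>
  vertices of total weight at least 1 are then adjacent to all or none of its corners, against
  \<open>N = 0\<close>.\<close>

lemma x_pos_if_extremal:
  assumes N: "N = 0" and b: "0 < b"
    and codeg: "\<And>u v. u \<in> V \<Longrightarrow> v \<in> V \<Longrightarrow> adj u v \<Longrightarrow> codeg u v = b"
    and nonisolated: "\<And>v. v \<in> V \<Longrightarrow> \<exists>u\<in>V. adj v u"
    and v: "v \<in> V"
  shows "0 < x v"
proof (rule ccontr)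
  assume "\<not> 0 < x v"
  then have xv: "x v = 0" using x_nonneg[OF v] by simp
  then have "(\<Sum>u\<in>V. a v u * x u) = 0" using a_eigen[OF v] by simp
  then have "\<forall>u\<in>V. a v u * x u = 0"
    by (simp add: sum_nonneg_eq_0_iff[OF finite_V] x_nonneg)
  then have nbr: "x u = 0" if "u \<in> V" "adj v u" for u
    using that by (auto simp: a_def)
  obtain u where u: "u \<in> V" "adj v u" using nonisolated[OF v] by blast
  have "codeg v u \<noteq> 0" using codeg[OF v u] b by simp
  then obtain w where w: "w \<in> V" "a v w * a u w \<noteq> 0"
    unfolding codeg_def by (meson sum.neutral)
  then have w': "adj v w" "adj u w" by (auto simp: a_def)
  have "tri v u w = 1" using u w' by (simp add: tri_def a_def)
  then have "\<forall>z\<in>V. x z * all_or_none v u w z = 0"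
    using N v u w(1) unfolding N_eq_0_iff by (metis mult_1)
  then have "(\<Sum>z\<in>V. x z * all_or_none v u w z) = 0"
    by (intro sum.neutral)
  moreover have "(\<Sum>z\<in>V. x z * all_or_none v u w z) \<ge> 1"
    using sum_all_or_none[OF v u(1) w(1)] xv nbr[OF u] nbr[OF w(1) w'(1)]
      wcodeg_nonneg[of v u] wcodeg_nonneg[of u w] wcodeg_nonneg[of v w] by simp
  ultimately show False by simp
qed

text \<open>\<open>N = 0\<close> restricts only vertices of positive weight, and by positivity these
  are all vertices. The first conclusion excludes \<open>K4\<close>, the second a triangle avoiding
  the closed neighbourhood of \<open>z\<close>.\<close>

lemma no_all_or_none:
  assumes "N = 0" and "\<And>v. v \<in> V \<Longrightarrow> 0 < x v"
    and "u \<in> V" "v \<in> V" "w \<in> V" "z \<in> V" and "adj u v" "adj v w" "adj u w"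
  shows "\<not> (adj u z \<and> adj v z \<and> adj w z)" and "adj u z \<or> adj v z \<or> adj w z"
proof -
  have "tri u v w * (x z * all_or_none u v w z) = 0"
    using assms(1,3-6) unfolding N_eq_0_iff by blast
  moreover have "x z \<noteq> 0" using assms(2)[of z] assms(6) by simp
  ultimately have "all_or_none u v w z = 0"
    using assms(7-9) by (simp add: tri_def a_def)
  then show "\<not> (adj u z \<and> adj v z \<and> adj w z)" and "adj u z \<or> adj v z \<or> adj w z"
    by (auto simp: all_or_none_def a_def)
qed

text \<open>Constant codegree turns \<open>S\<close>, \<open>P\<close> and \<open>R\<close> into
  \<open>b * M\<close>, \<open>b * R\<close> and \<open>b * lam\<close>, and \<open>N = 0\<close>
  becomes \<open>b\<close> times the wanted relation.\<close>

lemma formula_if_structure: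
  assumes codeg: "\<And>u v. u \<in> V \<Longrightarrow> v \<in> V \<Longrightarrow> adj u v \<Longrightarrow> codeg u v = b"
    and N: "N = 0" and lam: "0 < lam" and gt: "M < 2 * lam\<^sup>2"
  shows "b = lam - M / (3 * lam)"
proof -
  have ac: "a u v * codeg u v = b * a u v" if "u \<in> V" "v \<in> V" for u v
    using codeg[OF that] by (auto simp: a_def)
  have S: "S = b * M"
    unfolding S_def M_def sum_distrib_left by (intro sum.cong refl ac)
  have P: "P = b * R"
    unfolding P_def R_def sum_distrib_left
    by (intro sum.cong refl) (simp add: ac)
  have "R = (\<Sum>u\<in>V. \<Sum>v\<in>V. b * (a u v * x u))"
    unfolding R_codeg by (intro sum.cong refl) (simp add: ac)
  then have R: "R = b * lam"
    by (simp add: sum_distrib_left[symmetric] sum_a_x')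
  \<comment> \<open>Nosal's bound provides a triangle, so that \<open>b\<close> can be
    cancelled.\<close>
  have "b * lam > 0" using R_ge R gt by linarith
  then have b: "b \<noteq> 0" by auto
  have "b * M = b * (3 * (lam - b) * lam)"
    using N N_eq S P R by (simp add: algebra_simps)
  then have "M = 3 * (lam - b) * lam" using b by simp
  then show ?thesis using lam by (simp add: field_simps)
qed

end

section \<open>Cliques and common neighbours\<close>

lemma arcs_ends_induce_subgraph: "arcs_ends (G \<restriction> W) = arcs_ends G \<inter> W \<times> W"
  by (auto simp: arcs_ends_conv)

context graph
begin

lemma graphI_induced:
  assumes "induced_subgraph H G"
  shows "graph H"
proof -
  interpret D: digraph H using assms by (rule digraphI_induced)
  interpret S: sym_digraph H using assms by (rule induced_graph_imp_graph)
  show ?thesis by unfold_locales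
qed

lemma connectedI:
  assumes "verts G \<noteq> {}" and "\<And>u v. u \<in> verts G \<Longrightarrow> v \<in> verts G \<Longrightarrow> u \<rightarrow>\<^sup>*\<^bsub>G\<^esub> v"
  shows "Digraph_Component.connected G"
  using assms sym_arcs
  by (simp add: Digraph_Component.connected_def strongly_connected_def reachable_mk_symmetric_eq)

lemma card_arcs_ends: "card (arcs_ends G) = 2 * card (edge_set G)"
proof -
  let ?F = "\<lambda>e. {(u, v). u \<rightarrow>\<^bsub>G\<^esub> v \<and> {u, v} = e}"
  have fin: "finite (arcs_ends G)" by (simp add: arcs_ends_conv)
  have edges: "edge_set G = (\<lambda>(u, v). {u, v}) ` arcs_ends G"
    by (auto simp: edge_set_def)
  have "card (?F e) = 2" if edge: "e \<in> edge_set G" for e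
  proof -
    obtain u v where e: "e = {u, v}" "u \<rightarrow>\<^bsub>G\<^esub> v"
      using edge by (auto simp: edge_set_def)
    then have "v \<rightarrow>\<^bsub>G\<^esub> u" "u \<noteq> v"
      using graph_symmetric adj_not_same by auto
    then have "?F e = {(u, v), (v, u)}"
      using e by (auto simp: doubleton_eq_iff)
    then show ?thesis using \<open>u \<noteq> v\<close> by simp
  qed
  moreover have "arcs_ends G = (\<Union>e\<in>edge_set G. ?F e)"
    by (auto simp: edge_set_def)
  moreover have "card (\<Union>e\<in>edge_set G. ?F e) = (\<Sum>e\<in>edge_set G. card (?F e))"
  proof (rule card_UN_disjoint)
    show "finite (edge_set G)" using fin by (simp add: edges)
    show "\<forall>e\<in>edge_set G. finite (?F e)"
      using finite_subset[OF _ fin] by (auto intro: finite_subset[OF _ fin])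
    show "\<forall>e\<in>edge_set G. \<forall>e'\<in>edge_set G. e \<noteq> e' \<longrightarrow> ?F e \<inter> ?F e' = {}"
      by auto
  qed
  ultimately show ?thesis by simp
qed

text \<open>Without parallel arcs a complete subgraph contains every arc of \<open>G\<close> between
  its vertices, so it is induced. Copies of a complete graph thus correspond to cliques as vertex
  sets.\<close>

lemma complete_subgraphs_iff:
  "H \<in> complete_subgraphs n G \<longleftrightarrow>
    (\<exists>W \<subseteq> verts G. card W = n \<and> (\<forall>u\<in>W. \<forall>v\<in>W. u \<noteq> v \<longrightarrow> u \<rightarrow>\<^bsub>G\<^esub> v) \<and> H = G \<restriction> W)"
proof
  assume "H \<in> complete_subgraphs n G"
  then have sub: "subgraph H G" and K: "complete_digraph n H"
    by (auto simp: complete_subgraphs_def)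
  then have ends: "arcs_ends H = {(u, v). (u, v) \<in> verts H \<times> verts H \<and> u \<noteq> v}"
    and card: "card (verts H) = n" and th: "tail G = tail H" "head G = head H"
    and arcs: "arcs H \<subseteq> arcs G" and verts: "verts H \<subseteq> verts G"
    by (auto simp: complete_digraph_def subgraph_def compatible_def)
  interpret H: graph H using K by (simp add: complete_digraph_def)
  have adj: "u \<rightarrow>\<^bsub>G\<^esub> v" if "u \<in> verts H" "v \<in> verts H" "u \<noteq> v" for u v
  proof -
    have "(u, v) \<in> arcs_ends H" using that ends by simp
    then show ?thesis using adj_mono sub by blast
  qed
  have arcs_H: "arcs H = {e \<in> arcs G. tail G e \<in> verts H \<and> head G e \<in> verts H}"
  proof (intro equalityI subsetI)
    fix e assume "e \<in> arcs H"
    then show "e \<in> {e \<in> arcs G. tail G e \<in> verts H \<and> head G e \<in> verts H}"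
      using arcs th by auto
  next
    fix e assume e: "e \<in> {e \<in> arcs G. tail G e \<in> verts H \<and> head G e \<in> verts H}"
    then have "(tail G e, head G e) \<in> arcs_ends H"
      using no_loops ends by auto
    then obtain e' where e': "e' \<in> arcs H" "tail H e' = tail G e" "head H e' = head G e"
      by (auto simp: arcs_ends_conv)
    then have "e' = e"
      using e arcs th by (intro no_multi_arcs) (auto simp: arc_to_ends_def)
    then show "e \<in> arcs H" using e' by simp
  qed
  have "H = G \<restriction> verts H"
  proof (rule pre_digraph.equality)
    show "arcs H = arcs (G \<restriction> verts H)" using arcs_H by (simp only: induce_subgraph_arcs)
    show "pre_digraph.more H = pre_digraph.more (G \<restriction> verts H)" by simp
  qed (simp_all only: induce_subgraph_verts induce_subgraph_tail induce_subgraph_head th)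
  then show "\<exists>W \<subseteq> verts G. card W = n \<and> (\<forall>u\<in>W. \<forall>v\<in>W. u \<noteq> v \<longrightarrow> u \<rightarrow>\<^bsub>G\<^esub> v) \<and> H = G \<restriction> W"
    using verts card adj by (intro exI[of _ "verts H"] conjI ballI impI)
next
  assume "\<exists>W \<subseteq> verts G. card W = n \<and> (\<forall>u\<in>W. \<forall>v\<in>W. u \<noteq> v \<longrightarrow> u \<rightarrow>\<^bsub>G\<^esub> v) \<and> H = G \<restriction> W"
  then obtain W where W: "W \<subseteq> verts G" "card W = n"
      and adj: "\<forall>u\<in>W. \<forall>v\<in>W. u \<noteq> v \<longrightarrow> u \<rightarrow>\<^bsub>G\<^esub> v" and H: "H = G \<restriction> W"
    by blast
  have ind: "induced_subgraph H G"
    using W H by (simp add: induced_induce)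
  have "graph H" using ind by (rule graphI_induced)
  moreover have "arcs_ends H = {(u, v). (u, v) \<in> verts H \<times> verts H \<and> u \<noteq> v}"
    using adj adj_not_same by (auto simp: H arcs_ends_induce_subgraph)
  ultimately show "H \<in> complete_subgraphs n G"
    using W ind by (auto simp: complete_subgraphs_def complete_digraph_def H induced_imp_subgraph)
qed

lemma complete_free_iff:
  "complete_free n G \<longleftrightarrow>
    \<not> (\<exists>W \<subseteq> verts G. card W = n \<and> (\<forall>u\<in>W. \<forall>v\<in>W. u \<noteq> v \<longrightarrow> u \<rightarrow>\<^bsub>G\<^esub> v))"
  unfolding complete_free_def by (auto simp: complete_subgraphs_iff set_eq_iff)

lemma complete_free_delete_verts_iff:
  "complete_free n (delete_verts G S) \<longleftrightarrow>
    \<not> (\<exists>W \<subseteq> verts G - S. card W = n \<and> (\<forall>u\<in>W. \<forall>v\<in>W. u \<noteq> v \<longrightarrow> u \<rightarrow>\<^bsub>G\<^esub> v))"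
proof -
  let ?D = "delete_verts G S"
  have "induced_subgraph ?D G"
    unfolding delete_verts_def by (rule induced_induce) auto
  then interpret D: graph ?D by (rule graphI_induced)
  have verts: "verts ?D = verts G - S" by (simp add: delete_verts_def)
  have "(\<forall>u\<in>W. \<forall>v\<in>W. u \<noteq> v \<longrightarrow> u \<rightarrow>\<^bsub>?D\<^esub> v) \<longleftrightarrow>
      (\<forall>u\<in>W. \<forall>v\<in>W. u \<noteq> v \<longrightarrow> u \<rightarrow>\<^bsub>G\<^esub> v)" if "W \<subseteq> verts G - S" for W
    using that by (auto simp: delete_verts_def arcs_ends_induce_subgraph)
  then have "W \<subseteq> verts G - S \<and> card W = n \<and> (\<forall>u\<in>W. \<forall>v\<in>W. u \<noteq> v \<longrightarrow> u \<rightarrow>\<^bsub>?D\<^esub> v) \<longleftrightarrow>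
      W \<subseteq> verts G - S \<and> card W = n \<and> (\<forall>u\<in>W. \<forall>v\<in>W. u \<noteq> v \<longrightarrow> u \<rightarrow>\<^bsub>G\<^esub> v)" for W
    by (intro conj_cong refl)
  then show ?thesis
    unfolding D.complete_free_iff verts by (simp only:)
qed

text \<open>Sending a common neighbour \<open>w\<close> to the subgraph induced on
  \<open>{u, v, w}\<close> is a bijection.\<close>

lemma card_triangles_on_edge:
  assumes uv: "u \<rightarrow>\<^bsub>G\<^esub> v"
  shows "card (triangles_on_edge G u v) = card (neighborhood G u \<inter> neighborhood G v)"
proof -
  let ?C = "neighborhood G u \<inter> neighborhood G v"
  let ?f = "\<lambda>w. G \<restriction> {u, v, w}"
  have neq: "u \<noteq> v" using uv adj_not_same by auto
  have notin: "w \<noteq> u" "w \<noteq> v" if "w \<in> ?C" for w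
    using that adj_not_same by (auto simp: neighborhood_def)
  have sym: "\<And>p q. p \<rightarrow>\<^bsub>G\<^esub> q \<Longrightarrow> q \<rightarrow>\<^bsub>G\<^esub> p" by (rule graph_symmetric)
  have "inj_on ?f ?C"
  proof (rule inj_onI)
    fix w w' assume "w \<in> ?C" "w' \<in> ?C" "?f w = ?f w'"
    then have "{u, v, w} = {u, v, w'}" by (metis induce_subgraph_verts)
    then show "w = w'" using notin \<open>w \<in> ?C\<close> by auto
  qed
  moreover have "?f ` ?C = triangles_on_edge G u v"
  proof (intro equalityI subsetI)
    fix H assume "H \<in> ?f ` ?C"
    then obtain w where w: "w \<in> ?C" and H: "H = ?f w" by auto
    have adj: "u \<rightarrow>\<^bsub>G\<^esub> w" "v \<rightarrow>\<^bsub>G\<^esub> w" using w by (auto simp: neighborhood_def)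
    have "H \<in> complete_subgraphs 3 G"
      unfolding complete_subgraphs_iff H
      using adj uv neq notin[OF w] sym adj_in_verts
      by (intro exI[of _ "{u, v, w}"]) auto
    moreover have "u \<rightarrow>\<^bsub>H\<^esub> v"
      using uv by (simp add: H arcs_ends_induce_subgraph)
    ultimately show "H \<in> triangles_on_edge G u v" by (simp add: triangles_on_edge_def)
  next
    fix H assume "H \<in> triangles_on_edge G u v"
    then have "H \<in> complete_subgraphs 3 G" and uvH: "u \<rightarrow>\<^bsub>H\<^esub> v"
      by (auto simp: triangles_on_edge_def)
    then obtain W where W: "card W = 3" "\<forall>p\<in>W. \<forall>q\<in>W. p \<noteq> q \<longrightarrow> p \<rightarrow>\<^bsub>G\<^esub> q"
        and H: "H = G \<restriction> W"
      unfolding complete_subgraphs_iff by blast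
    have uvW: "u \<in> W" "v \<in> W" using uvH by (auto simp: H arcs_ends_induce_subgraph)
    have "card (W - {u, v}) = 1"
      using uvW neq W(1) by (simp add: card_Diff_subset)
    then obtain w where "W - {u, v} = {w}" by (auto simp: card_1_singleton_iff)
    then have "W = {u, v, w}" "w \<noteq> u" "w \<noteq> v" using uvW by auto
    then show "H \<in> ?f ` ?C"
      using W(2) H by (auto simp: neighborhood_def)
  qed
  ultimately show ?thesis by (metis card_image)
qed

lemma card_common_neighborhood_le_booksize:
  assumes "u \<rightarrow>\<^bsub>G\<^esub> v"
  shows "card (neighborhood G u \<inter> neighborhood G v) \<le> booksize G"
proof -
  let ?B = "{card (neighborhood G u \<inter> neighborhood G v) | u v. u \<rightarrow>\<^bsub>G\<^esub> v}"
  have "?B = (\<lambda>(u, v). card (neighborhood G u \<inter> neighborhood G v)) ` arcs_ends G"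
    by force
  then have "finite ?B" by (simp add: arcs_ends_conv)
  then show ?thesis
    using assms unfolding booksize_def by (intro Max_ge) auto
qed

text \<open>The eigenvector on indices is carried over to vertices along the enumeration and divided
  by its sum.\<close>

lemma ex_adjacency_eigenvector:
  assumes "verts G \<noteq> {}"
  obtains x where "adjacency_eigenvector (verts G) (dominates G) x (graph_spectral_radius G)"
proof -
  \<comment> \<open>The same choice term as in \<open>graph_spectral_radius\<close>, so that both
    speak of one matrix.\<close>
  define vs where "vs = (SOME vs. distinct vs \<and> set vs = verts G)"
  have vs: "distinct vs \<and> set vs = verts G"
    unfolding vs_def by (rule someI_ex) (use finite_distinct_list[OF finite_verts] in blast)
  define n where "n = length vs"
  have n: "n > 0" using vs assms by (auto simp: n_def)
  define a :: "nat \<Rightarrow> nat \<Rightarrow> real" where "a i j = of_bool (vs ! i \<rightarrow>\<^bsub>G\<^esub> vs ! j)" for i j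
  have A: "adjacency_matrix G vs = complex_mat n a"
    by (rule eq_matI) (auto simp: adjacency_matrix_def complex_mat_def a_def n_def)
  have sr: "graph_spectral_radius G = spectral_radius (complex_mat n a)"
    unfolding graph_spectral_radius_def vs_def[symmetric] A ..
  obtain y where y: "\<And>i. i < n \<Longrightarrow> 0 \<le> y i" "\<exists>i<n. y i \<noteq> 0"
      and ev: "\<And>i. i < n \<Longrightarrow> (\<Sum>j<n. a i j * y j) = graph_spectral_radius G * y i"
    unfolding sr
  proof (rule nonneg_eigenvector_spectral_radius[of a n])
    show "a i j = a j i" for i j using graph_symmetric by (auto simp: a_def)
  qed (auto simp: a_def n)
  have bij: "bij_betw ((!) vs) {..<n} (verts G)"
    using bij_betw_nth[of vs "{..<n}" "verts G"] vs by (simp add: n_def)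
  define s where "s = (\<Sum>i<n. y i)"
  have s: "s > 0"
  proof -
    obtain i where "i < n" "y i \<noteq> 0" using y(2) by blast
    then show ?thesis
      unfolding s_def using y(1) by (intro sum_pos2[of _ i]) (auto simp: less_le)
  qed
  define ix where "ix = the_inv_into {..<n} ((!) vs)"
  have ix: "ix (vs ! i) = i" if "i < n" for i
    unfolding ix_def using bij that by (intro the_inv_into_f_f) (auto simp: bij_betw_def)
  define x where "x v = y (ix v) / s" for v
  have sum: "(\<Sum>v\<in>verts G. f v) = (\<Sum>i<n. f (vs ! i))" for f :: "'a \<Rightarrow> real"
    using sum.reindex_bij_betw[OF bij, of f] by simp
  have vert: "\<exists>i<n. v = vs ! i" if "v \<in> verts G" for v
    using bij that by (auto simp: bij_betw_def)
  have "adjacency_eigenvector (verts G) (dominates G) x (graph_spectral_radius G)"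
  proof
    show "finite (verts G)" by simp
    show "v \<rightarrow>\<^bsub>G\<^esub> u" if "u \<rightarrow>\<^bsub>G\<^esub> v" for u v using that by (rule graph_symmetric)
    show "0 \<le> x v" if "v \<in> verts G" for v
      using vert[OF that] y(1) s by (auto simp: x_def ix)
    show "(\<Sum>v\<in>verts G. x v) = 1"
      using s by (simp add: sum x_def ix sum_divide_distrib[symmetric] s_def[symmetric])
    show "(\<Sum>v\<in>verts G. of_bool (u \<rightarrow>\<^bsub>G\<^esub> v) * x v) = graph_spectral_radius G * x u"
      if u: "u \<in> verts G" for u
    proof -
      obtain i where i: "i < n" "u = vs ! i" using vert[OF u] by blast
      have "(\<Sum>v\<in>verts G. of_bool (u \<rightarrow>\<^bsub>G\<^esub> v) * x v) = (\<Sum>j<n. a i j * y j) / s"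
        unfolding sum sum_divide_distrib
        by (rule sum.cong[OF refl]) (simp add: a_def i x_def ix)
      then show ?thesis using ev i by (simp add: x_def ix)
    qed
  qed
  then show ?thesis using that by blast
qed

text \<open>Adjacent vertices are both reachable from \<open>u\<close> or both not, so cutting
  \<open>x\<close> off outside the component of \<open>u\<close> preserves every eigenvalue
  equation.\<close>

lemma restrict_adjacency_eigenvector:
  assumes x: "adjacency_eigenvector (verts G) (dominates G) x l"
    and pos: "\<And>v. v \<in> verts G \<Longrightarrow> 0 < x v"
    and u: "u \<in> verts G"
  obtains s where
    "adjacency_eigenvector (verts G) (dominates G) (\<lambda>v. of_bool (u \<rightarrow>\<^sup>*\<^bsub>G\<^esub> v) * x v / s) l"
proof -
  interpret adjacency_eigenvector "verts G" "dominates G" x l by (fact x)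
  let ?k = "\<lambda>v. of_bool (u \<rightarrow>\<^sup>*\<^bsub>G\<^esub> v) :: real"
  define s where "s = (\<Sum>v\<in>verts G. ?k v * x v)"
  have s: "s > 0"
    unfolding s_def using u pos by (intro sum_pos2[of _ u]) (auto simp: less_imp_le)
  have k: "of_bool (v \<rightarrow>\<^bsub>G\<^esub> w) * ?k w = ?k v * of_bool (v \<rightarrow>\<^bsub>G\<^esub> w)" for v w
    using reachable_adj_trans graph_symmetric by (auto simp: of_bool_def)
  have "adjacency_eigenvector (verts G) (dominates G) (\<lambda>v. ?k v * x v / s) l"
  proof
    show "finite (verts G)" by simp
    show "v \<rightarrow>\<^bsub>G\<^esub> u" if "u \<rightarrow>\<^bsub>G\<^esub> v" for u v using that by (rule graph_symmetric)
    show "0 \<le> ?k v * x v / s" if "v \<in> verts G" for v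
      using x_nonneg[OF that] s by simp
    show "(\<Sum>v\<in>verts G. ?k v * x v / s) = 1"
      using s by (simp only: sum_divide_distrib[symmetric] s_def[symmetric]) simp
    show "(\<Sum>w\<in>verts G. of_bool (v \<rightarrow>\<^bsub>G\<^esub> w) * (?k w * x w / s)) = l * (?k v * x v / s)"
      if "v \<in> verts G" for v
    proof -
      have "(\<Sum>w\<in>verts G. of_bool (v \<rightarrow>\<^bsub>G\<^esub> w) * (?k w * x w / s)) =
          (\<Sum>w\<in>verts G. ?k v / s * (of_bool (v \<rightarrow>\<^bsub>G\<^esub> w) * x w))"
      proof (rule sum.cong[OF refl])
        fix w
        have "of_bool (v \<rightarrow>\<^bsub>G\<^esub> w) * (?k w * x w / s) = (of_bool (v \<rightarrow>\<^bsub>G\<^esub> w) * ?k w) * x w / s"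
          by simp
        then show "of_bool (v \<rightarrow>\<^bsub>G\<^esub> w) * (?k w * x w / s) =
            ?k v / s * (of_bool (v \<rightarrow>\<^bsub>G\<^esub> w) * x w)"
          unfolding k by simp
      qed
      also have "\<dots> = ?k v / s * (l * x v)"
        by (simp only: sum_distrib_left[symmetric] eigen[OF that])
      finally show ?thesis by simp
    qed
  qed
  then show ?thesis using that by blast
qed

end

section \<open>Equality in the booksize bound characterised by the structure of the graph\<close>

theorem proposition2p5:
  fixes G :: "('a, 'b) pre_digraph" and m \<beta> :: nat and lam :: real
  assumes "graph G"
    and "no_isolated_verts G"
    and "m = card (edge_set G)"
    and "m \<ge> 1"
    and "lam = graph_spectral_radius G"
    and "\<beta> = booksize G"
    and "lam ^ 2 > real m"
  shows "real \<beta> = lam - 2 * real m / (3 * lam) \<longleftrightarrow>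
    Digraph_Component.connected G \<and>
    complete_free 4 G \<and>
    (\<forall>u v. u \<rightarrow>\<^bsub>G\<^esub> v \<longrightarrow> card (triangles_on_edge G u v) = \<beta>) \<and>
    (\<forall>v \<in> verts G. complete_free 3 (delete_verts G (closed_neighborhood G v)))"
proof -
  interpret graph G by fact
  let ?V = "verts G"
  have edge: "\<exists>u v. u \<rightarrow>\<^bsub>G\<^esub> v"
  proof (rule ccontr)
    assume "\<not> ?thesis"
    then have "edge_set G = {}" by (auto simp: edge_set_def)
    then show False using assms(3,4) by simp
  qed
  then have V: "?V \<noteq> {}" using adj_in_verts by blast
  obtain x where x: "adjacency_eigenvector ?V (dominates G) x lam"
    using ex_adjacency_eigenvector[OF V] assms(5) by blast
  interpret adjacency_eigenvector ?V "dominates G" x lam by (fact x)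
  have lam: "lam > 0"
  proof -
    have "lam \<ge> 0"
      unfolding sum_a_x[symmetric] by (intro sum_nonneg mult_nonneg_nonneg a_nonneg x_nonneg)
    moreover have "lam \<noteq> 0" using assms(4,7) by auto
    ultimately show ?thesis by simp
  qed
  have M: "M = 2 * real m"
  proof -
    have "M = (\<Sum>p\<in>?V \<times> ?V. of_bool (p \<in> arcs_ends G))"
      unfolding M_def a_def sum.cartesian_product by (intro sum.cong refl) auto
    also have "\<dots> = real (card (?V \<times> ?V \<inter> {p. p \<in> arcs_ends G}))"
      by (simp add: sum.If_cases of_bool_def)
    also have "?V \<times> ?V \<inter> {p. p \<in> arcs_ends G} = arcs_ends G"
      using adj_in_verts by auto
    finally show ?thesis by (simp add: card_arcs_ends assms(3))
  qed
  have Mpos: "0 < M" and Mlt: "M < 2 * lam\<^sup>2" using M assms(4,7) by auto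
  have formula: "lam - 2 * real m / (3 * lam) = lam - M / (3 * lam)" by (simp add: M)
  have codeg: "codeg u v = real (card (neighborhood G u \<inter> neighborhood G v))" for u v
  proof -
    have "codeg u v = (\<Sum>w\<in>?V. of_bool (w \<in> neighborhood G u \<inter> neighborhood G v))"
      unfolding codeg_def a_def by (intro sum.cong refl) (auto simp: neighborhood_def)
    also have "\<dots> = real (card (?V \<inter> {w. w \<in> neighborhood G u \<inter> neighborhood G v}))"
      by (simp only: sum.If_cases of_bool_def finite_verts) simp
    also have "?V \<inter> {w. w \<in> neighborhood G u \<inter> neighborhood G v} =
        neighborhood G u \<inter> neighborhood G v"
      using adj_in_verts(2) by (auto simp: neighborhood_def)
    finally show ?thesis .
  qed
  have codeg_le: "codeg u v \<le> real \<beta>" if "u \<rightarrow>\<^bsub>G\<^esub> v" for u v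
    using card_common_neighborhood_le_booksize[OF that] by (simp add: codeg assms(6))
  have nonisolated: "\<exists>u\<in>?V. v \<rightarrow>\<^bsub>G\<^esub> u" if v: "v \<in> ?V" for v
  proof -
    obtain u where "v \<rightarrow>\<^bsub>G\<^esub> u"
      using assms(2) v unfolding no_isolated_verts_def neighborhood_def by blast
    then show ?thesis using adj_in_verts(2) by blast
  qed
  show ?thesis
  proof
    assume "real \<beta> = lam - 2 * real m / (3 * lam)"
    then have b: "real \<beta> = lam - M / (3 * lam)" by (simp add: formula)
    note ext = extremal[OF codeg_le Mpos lam Mlt b]
    have codeg_eq: "codeg u v = real \<beta>" if "u \<rightarrow>\<^bsub>G\<^esub> v" for u v
      using codeg_eq_if_S_eq[OF codeg_le ext(2)] that adj_in_verts by blast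
    \<comment> \<open>Stated for every nonnegative eigenvector, since it is applied both to
      \<open>x\<close> and to its restriction to a component.\<close>
    have pos: "0 < x' v" if "adjacency_eigenvector ?V (dominates G) x' lam" "v \<in> ?V" for x' v
    proof -
      interpret x': adjacency_eigenvector ?V "dominates G" x' lam by fact
      have "x'.N = 0" by (rule x'.extremal(3)[OF codeg_le Mpos lam Mlt b])
      then show ?thesis
        by (rule x'.x_pos_if_extremal) (use ext(1) codeg_eq nonisolated that in auto)
    qed
    note two = no_all_or_none[OF ext(3) pos[OF x]]
    have "Digraph_Component.connected G"
    proof (rule connectedI[OF V])
      fix u v assume uv: "u \<in> ?V" "v \<in> ?V"
      obtain s where s:
        "adjacency_eigenvector ?V (dominates G) (\<lambda>v. of_bool (u \<rightarrow>\<^sup>*\<^bsub>G\<^esub> v) * x v / s) lam"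
        using restrict_adjacency_eigenvector[OF x pos[OF x] uv(1)] by blast
      \<comment> \<open>If \<open>v\<close> were not reachable, the restricted eigenvector would
        vanish there.\<close>
      show "u \<rightarrow>\<^sup>*\<^bsub>G\<^esub> v"
        using pos[OF s uv(2)] by (cases "u \<rightarrow>\<^sup>*\<^bsub>G\<^esub> v") auto
    qed
    moreover have "complete_free 4 G"
      unfolding complete_free_iff
    proof clarify
      fix W assume W: "W \<subseteq> ?V" "card W = 4" "\<forall>u\<in>W. \<forall>v\<in>W. u \<noteq> v \<longrightarrow> u \<rightarrow>\<^bsub>G\<^esub> v"
      then obtain z where z: "z \<in> W" by fastforce
      then have "card (W - {z}) = 3" using W(2) by simp
      then obtain u v w where uvw: "W - {z} = {u, v, w}" "u \<noteq> v" "v \<noteq> w" "u \<noteq> w"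
        by (auto simp: card_3_iff)
      then have "u \<in> W" "v \<in> W" "w \<in> W" "u \<noteq> z" "v \<noteq> z" "w \<noteq> z" by auto
      then show False using two(1)[of u v w z] uvw(2-) W z by blast
    qed
    moreover have "card (triangles_on_edge G u v) = \<beta>" if "u \<rightarrow>\<^bsub>G\<^esub> v" for u v
      using codeg_eq[OF that] by (simp add: card_triangles_on_edge[OF that] codeg)
    moreover have "complete_free 3 (delete_verts G (closed_neighborhood G z))" if z: "z \<in> ?V" for z
      unfolding complete_free_delete_verts_iff
    proof clarify
      fix W assume W: "W \<subseteq> ?V - closed_neighborhood G z" "card W = 3"
        "\<forall>u\<in>W. \<forall>v\<in>W. u \<noteq> v \<longrightarrow> u \<rightarrow>\<^bsub>G\<^esub> v"
      then obtain u v w where uvw: "W = {u, v, w}" "u \<noteq> v" "v \<noteq> w" "u \<noteq> w"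
        by (auto simp: card_3_iff)
      have "\<not> p \<rightarrow>\<^bsub>G\<^esub> z" if "p \<in> W" for p
        using W(1) that graph_symmetric
        unfolding closed_neighborhood_def neighborhood_def by blast
      then show False using two(2)[of u v w z] uvw W z by blast
    qed
    ultimately show "Digraph_Component.connected G \<and> complete_free 4 G \<and>
      (\<forall>u v. u \<rightarrow>\<^bsub>G\<^esub> v \<longrightarrow> card (triangles_on_edge G u v) = \<beta>) \<and>
      (\<forall>v \<in> verts G. complete_free 3 (delete_verts G (closed_neighborhood G v)))"
      by blast
  next
    assume "Digraph_Component.connected G \<and> complete_free 4 G \<and>
      (\<forall>u v. u \<rightarrow>\<^bsub>G\<^esub> v \<longrightarrow> card (triangles_on_edge G u v) = \<beta>) \<and>
      (\<forall>v \<in> verts G. complete_free 3 (delete_verts G (closed_neighborhood G v)))"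
    then have K4: "complete_free 4 G"
      and tri: "\<And>u v. u \<rightarrow>\<^bsub>G\<^esub> v \<Longrightarrow> card (triangles_on_edge G u v) = \<beta>"
      and K3: "\<And>v. v \<in> ?V \<Longrightarrow> complete_free 3 (delete_verts G (closed_neighborhood G v))"
      by blast+
    \<comment> \<open>Adjacency of \<open>z\<close> to all three corners would give a
      \<open>K4\<close>, and to none a triangle in the graph without the closed neighbourhood of
      \<open>z\<close>.\<close>
    have "all_or_none u v w z = 0"
      if V: "u \<in> ?V" "v \<in> ?V" "w \<in> ?V" "z \<in> ?V"
        and adj: "u \<rightarrow>\<^bsub>G\<^esub> v" "v \<rightarrow>\<^bsub>G\<^esub> w" "u \<rightarrow>\<^bsub>G\<^esub> w" for u v w z
    proof -
      have neq: "u \<noteq> v" "v \<noteq> w" "u \<noteq> w" using adj adj_not_same by auto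
      note adj' = adj adj[THEN graph_symmetric]
      have "\<not> (u \<rightarrow>\<^bsub>G\<^esub> z \<and> v \<rightarrow>\<^bsub>G\<^esub> z \<and> w \<rightarrow>\<^bsub>G\<^esub> z)"
      proof
        assume z: "u \<rightarrow>\<^bsub>G\<^esub> z \<and> v \<rightarrow>\<^bsub>G\<^esub> z \<and> w \<rightarrow>\<^bsub>G\<^esub> z"
        then have "z \<noteq> u" "z \<noteq> v" "z \<noteq> w" using adj_not_same by auto
        then have "\<exists>W\<subseteq>?V. card W = 4 \<and> (\<forall>u\<in>W. \<forall>v\<in>W. u \<noteq> v \<longrightarrow> u \<rightarrow>\<^bsub>G\<^esub> v)"
          using neq z adj' V graph_symmetric[of u z] graph_symmetric[of v z] graph_symmetric[of w z]
          by (intro exI[of _ "{u, v, w, z}"]) simp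
        then show False using K4 unfolding complete_free_iff by blast
      qed
      moreover have "u \<rightarrow>\<^bsub>G\<^esub> z \<or> v \<rightarrow>\<^bsub>G\<^esub> z \<or> w \<rightarrow>\<^bsub>G\<^esub> z"
      proof (rule ccontr)
        assume z: "\<not> ?thesis"
        \<comment> \<open>A corner equal to \<open>z\<close> would make the other two corners
          adjacent to \<open>z\<close>, so \<open>z\<close> is off the triangle.\<close>
        then have "p \<notin> closed_neighborhood G z" if "p \<in> {u, v, w}" for p
          using that z adj' graph_symmetric
          unfolding closed_neighborhood_def neighborhood_def by blast
        then have "\<exists>W\<subseteq>?V - closed_neighborhood G z. card W = 3 \<and>
            (\<forall>u\<in>W. \<forall>v\<in>W. u \<noteq> v \<longrightarrow> u \<rightarrow>\<^bsub>G\<^esub> v)"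
          using neq adj' V by (intro exI[of _ "{u, v, w}"]) simp
        then show False using K3[OF V(4)] unfolding complete_free_delete_verts_iff by blast
      qed
      ultimately show ?thesis by (auto simp: all_or_none_def a_def)
    qed
    then have "tri u v w * (x z * all_or_none u v w z) = 0"
      if "u \<in> ?V" "v \<in> ?V" "w \<in> ?V" "z \<in> ?V" for u v w z
      using that by (auto simp: tri_def a_def)
    then have "N = 0" unfolding N_eq_0_iff by blast
    moreover have "codeg u v = real \<beta>" if "u \<rightarrow>\<^bsub>G\<^esub> v" for u v
      using tri[OF that] by (simp add: codeg card_triangles_on_edge[OF that])
    ultimately have "real \<beta> = lam - M / (3 * lam)"
      by (intro formula_if_structure lam Mlt)
    then show "real \<beta> = lam - 2 * real m / (3 * lam)" by (simp add: formula)
  qed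
qed

end
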